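(* Let $H$ be a numerical semigroup minimally generated by $b_1<\dots<b_m$, with conductor valuation $c$. The ring $S=\Bbbk[[H]]$ has maximal reduced type if and only if $\min_{x\in\operatorname{PF}(H)}x\geq c-b_1$.
   Context: $\Bbbk$ is an algebraically closed field of characteristic $0$. A numerical semigroup is a submonoid $H$ of $\mathbb N=\{0,1,2,\dots\}$ with finite complement ($H\neq\mathbb N$, since rings in the paper are non-regular). $S=\Bbbk[[H]]=\Bbbk[[t^{b_1},\dots,t^{b_m}]]\subseteq\overline S=\Bbbk[[t]]$, with maximal ideal $\mathfrak n$. The conductor valuation $c$ is the least integer with $c+i\in H$ for all $i\ge0$; the conductor ideal of $S$ is $\mathfrak C=t^c\overline S$. The reduced type is $s(S)=\dim_\Bbbk\frac{\mathfrak C+t^{b_1}S}{t^{b_1}S}$ and the Cohen–Macaulay type is $\operatorname{type}(S)=\dim_\Bbbk\frac{t^{b_1}S:_S\mathfrak n}{t^{b_1}S}$. $S$ is of maximal reduced type if $s(S)=\operatorname{type}(S)$. The pseudo-Frobenius set is $\operatorname{PF}(H)=\{x\in\mathbb Z\setminus H : x+h\in H\text{ for all }0\ne h\in H\}$; its largest element is $c-1$ and $|\operatorname{PF}(H)|=\operatorname{type}(S)$. *)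

theory Defs
  imports
    "HOL-Algebra.Algebra"
    "HOL-Computational_Algebra.Formal_Power_Series"
    "HOL-Computational_Algebra.Polynomial"
    "HOL.Hull"
begin

definition nat_submonoid :: "nat set \<Rightarrow> bool" where
  "nat_submonoid H \<longleftrightarrow> 0 \<in> H \<and> (\<forall>x\<in>H. \<forall>y\<in>H. x + y \<in> H)"

definition numerical_semigroup :: "nat set \<Rightarrow> bool" where
  "numerical_semigroup H \<longleftrightarrow> nat_submonoid H \<and> finite (UNIV - H)"

definition minimally_generates :: "nat set \<Rightarrow> nat set \<Rightarrow> bool" where
  "minimally_generates B H \<longleftrightarrow>
     nat_submonoid hull B = H \<and> (\<forall>B'. B' \<subset> B \<longrightarrow> nat_submonoid hull B' \<noteq> H)"

definition conductor :: "nat set \<Rightarrow> nat" where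
  "conductor H = (LEAST c. \<forall>i. c + i \<in> H)"

definition PF :: "nat set \<Rightarrow> int set" where
  "PF H = {x. x \<notin> int ` H \<and> (\<forall>h\<in>H. h \<noteq> 0 \<longrightarrow> x + int h \<in> int ` H)}"

text \<open>The ring \<open>k[[H]]\<close>, as the ring of all power series in \<open>t\<close> with support in \<open>H\<close>;
  the variable \<open>t\<close> is \<open>fps_X\<close>.\<close>

definition semigroup_ring :: "nat set \<Rightarrow> 'k::field fps ring" where
  "semigroup_ring H =
     \<lparr>carrier = {f. \<forall>n. fps_nth f n \<noteq> 0 \<longrightarrow> n \<in> H},
      monoid.mult = (*), one = 1, ring.zero = 0, ring.add = (+)\<rparr>"

text \<open>The conductor ideal \<open>t^c k[[t]]\<close>; the factor ranges over all power series.\<close>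

definition conductor_ideal :: "nat set \<Rightarrow> 'k::field fps set" where
  "conductor_ideal H = range (\<lambda>f. fps_X ^ conductor H * f)"

text \<open>Only meaningful for local rings.\<close>

definition the_maximal_ideal :: "('a, 'b) ring_scheme \<Rightarrow> 'a set" where
  "the_maximal_ideal R = (THE M. maximalideal M R)"

definition colon_ideal :: "('a, 'b) ring_scheme \<Rightarrow> 'a set \<Rightarrow> 'a set \<Rightarrow> 'a set" where
  "colon_ideal R I J = {x \<in> carrier R. \<forall>y\<in>J. x \<otimes>\<^bsub>R\<^esub> y \<in> I}"

text \<open>The dimension of \<open>J / I\<close> over \<open>k\<close>, for ideals \<open>I \<subseteq> J\<close> of a ring \<open>R\<close> of power series that
  contains the constants. The space \<open>J / I\<close> is the set of cosets of \<open>I\<close> by elements of \<open>J\<close>,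
  inside the quotient ring \<open>R / I\<close>. The field \<open>k\<close> acts on \<open>R / I\<close> by multiplication with the
  classes of the constant power series; for a proper ideal \<open>I\<close> these form a subfield of
  \<open>R / I\<close> isomorphic to \<open>k\<close>, as the library's dimension requires.\<close>

definition quotient_dim :: "'k::field fps ring \<Rightarrow> 'k fps set \<Rightarrow> 'k fps set \<Rightarrow> nat" where
  "quotient_dim R J I =
     ring.dim (R Quot I)
       (range (\<lambda>a. I +>\<^bsub>R\<^esub> fps_const a))
       ((\<lambda>x. I +>\<^bsub>R\<^esub> x) ` J)"

text \<open>In the following definitions \<open>b\<^sub>1\<close> is the least of the minimal generators of \<open>H\<close>, and the
  first argument fixes the field of coefficients.\<close>

definition reduced_type :: "'k::field itself \<Rightarrow> nat set \<Rightarrow> nat \<Rightarrow> nat" where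
  "reduced_type _ H b\<^sub>1 =
     (let S = (semigroup_ring H :: 'k fps ring);
          I = PIdl\<^bsub>S\<^esub> (fps_X ^ b\<^sub>1)
      in quotient_dim S (conductor_ideal H <+>\<^bsub>S\<^esub> I) I)"

definition cm_type :: "'k::field itself \<Rightarrow> nat set \<Rightarrow> nat \<Rightarrow> nat" where
  "cm_type _ H b\<^sub>1 =
     (let S = (semigroup_ring H :: 'k fps ring);
          I = PIdl\<^bsub>S\<^esub> (fps_X ^ b\<^sub>1)
      in quotient_dim S (colon_ideal S I (the_maximal_ideal S)) I)"

definition maximal_reduced_type :: "'k::field itself \<Rightarrow> nat set \<Rightarrow> nat \<Rightarrow> bool" where
  "maximal_reduced_type k H b\<^sub>1 \<longleftrightarrow> reduced_type k H b\<^sub>1 = cm_type k H b\<^sub>1"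

end

theory Submission
  imports Defs
begin

text \<open>Both dimension counts are monomial: if an ideal \<open>J\<close> consists of the series supported
  on \<open>A \<union> (b\<^sub>1 + H)\<close>, where \<open>A \<subseteq> H\<close> is disjoint from \<open>b\<^sub>1 + H\<close>, then the classes of \<open>t\<^sup>a\<close> for
  \<open>a \<in> A\<close> form a basis of \<open>J / t\<^bsup>b\<^sub>1\<^esup>S\<close>. For the reduced type, \<open>A\<close> is the set of all \<open>n \<ge> c\<close>
  outside \<open>b\<^sub>1 + H\<close>; for the Cohen--Macaulay type it is \<open>b\<^sub>1 + PF(H)\<close>. The first set is contained
  in the second one, so the two types agree iff the sets do, that is, iff every element of
  \<open>b\<^sub>1 + PF(H)\<close> is at least \<open>c\<close>.\<close>

section \<open>Power series with support in a submonoid\<close>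

text \<open>This is the carrier of the semigroup ring with an arbitrary support set in place of
  \<open>H\<close>. Every ideal below has this form, so statements on ideals become statements on
  sets of exponents.\<close>

definition series_on :: "nat set \<Rightarrow> 'k::zero fps set" where
  "series_on A = {f. \<forall>n. fps_nth f n \<noteq> 0 \<longrightarrow> n \<in> A}"

lemma semigroup_ring_simps [simp]:
  "carrier (semigroup_ring H) = series_on H"
  "x \<otimes>\<^bsub>semigroup_ring H\<^esub> y = x * y"
  "x \<oplus>\<^bsub>semigroup_ring H\<^esub> y = x + y"
  "\<one>\<^bsub>semigroup_ring H\<^esub> = 1"
  "\<zero>\<^bsub>semigroup_ring H\<^esub> = 0"
  by (simp_all add: semigroup_ring_def series_on_def)

lemma series_on_nth: "f \<in> series_on A \<Longrightarrow> n \<notin> A \<Longrightarrow> fps_nth f n = 0"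
  by (auto simp: series_on_def)

lemma series_on_mono: "A \<subseteq> B \<Longrightarrow> series_on A \<subseteq> series_on B"
  by (auto simp: series_on_def)

lemma series_on_0 [simp]: "0 \<in> series_on A"
  by (simp add: series_on_def)

lemma series_on_add:
  fixes f g :: "'k::monoid_add fps"
  shows "f \<in> series_on A \<Longrightarrow> g \<in> series_on A \<Longrightarrow> f + g \<in> series_on A"
  by (auto simp: series_on_def) (metis add_0)

lemma series_on_uminus:
  fixes f :: "'k::group_add fps"
  shows "f \<in> series_on A \<Longrightarrow> - f \<in> series_on A"
  by (simp add: series_on_def)

text \<open>A nonzero coefficient of a product needs a nonzero term in the convolution sum. The
  separate target \<open>C\<close> lets the rule serve ring closure, absorption by ideals and colon
  ideals alike.\<close>

lemma series_on_mult:
  fixes f g :: "'k::semiring_0 fps"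
  assumes "f \<in> series_on A" "g \<in> series_on B" "\<And>x y. x \<in> A \<Longrightarrow> y \<in> B \<Longrightarrow> x + y \<in> C"
  shows "f * g \<in> series_on C"
proof -
  have "n \<in> C" if "fps_nth (f * g) n \<noteq> 0" for n
  proof -
    from that obtain i where i: "i \<in> {0..n}" "fps_nth f i * fps_nth g (n - i) \<noteq> 0"
      unfolding fps_mult_nth by (meson sum.not_neutral_contains_not_neutral)
    then have "fps_nth f i \<noteq> 0" "fps_nth g (n - i) \<noteq> 0" by auto
    then have "i \<in> A" "n - i \<in> B"
      using assms(1,2) by (auto simp: series_on_def)
    from assms(3)[OF this] i show ?thesis by simp
  qed
  then show ?thesis by (simp add: series_on_def)
qed

lemma fps_X_power_in_series_on: "n \<in> A \<Longrightarrow> (fps_X ^ n :: 'k::semiring_1 fps) \<in> series_on A"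
  by (auto simp: series_on_def)

lemma fps_const_in_series_on: "0 \<in> A \<Longrightarrow> fps_const a \<in> series_on A"
  by (auto simp: series_on_def)

text \<open>The recursion for the coefficients of \<open>inverse f\<close> writes an exponent with
  nonzero coefficient as a sum of an exponent of \<open>f\<close> and a smaller exponent of
  \<open>inverse f\<close>. This is what makes the semigroup ring local.\<close>

lemma inverse_in_series_on:
  fixes f :: "'k::field fps"
  assumes H: "nat_submonoid H" and f: "f \<in> series_on H" "fps_nth f 0 \<noteq> 0"
  shows "inverse f \<in> series_on H"
proof -
  have "n \<in> H" if "fps_nth (inverse f) n \<noteq> 0" for n
    using that
  proof (induction n rule: less_induct)
    case (less n)
    show ?case
    proof (cases "n = 0")
      case True
      then show ?thesis using H by (simp add: nat_submonoid_def)
    next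
      case False
      \<comment> \<open>Compare coefficients at \<open>n\<close> in \<open>f * inverse f = 1\<close>
        and isolate the term \<open>i = 0\<close>; starting the sum at 1 keeps \<open>n - i\<close>
        below \<open>n\<close> for the induction hypothesis.\<close>
      have "fps_nth (inverse f) n
          = - inverse (fps_nth f 0) * (\<Sum>i=1..n. fps_nth f i * fps_nth (inverse f) (n - i))"
      proof -
        have "0 = fps_nth (f * inverse f) n"
          using False f(2) by (simp add: inverse_mult_eq_1')
        also have "\<dots> = fps_nth f 0 * fps_nth (inverse f) n
            + (\<Sum>i=1..n. fps_nth f i * fps_nth (inverse f) (n - i))"
          unfolding fps_mult_nth by (simp add: sum.atLeast_Suc_atMost)
        finally show ?thesis
          using f(2) by (simp add: field_simps eq_neg_iff_add_eq_0)
      qed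
      with less.prems have "(\<Sum>i=1..n. fps_nth f i * fps_nth (inverse f) (n - i)) \<noteq> 0"
        by auto
      then obtain i where i: "i \<in> {1..n}" "fps_nth f i * fps_nth (inverse f) (n - i) \<noteq> 0"
        by (meson sum.not_neutral_contains_not_neutral)
      then have "i \<in> H" "n - i \<in> H"
        using f(1) less.IH[of "n - i"] by (auto simp: series_on_def)
      with H i have "i + (n - i) \<in> H" unfolding nat_submonoid_def by blast
      with i show ?thesis by simp
    qed
  qed
  then show ?thesis by (simp add: series_on_def)
qed

section \<open>The semigroup ring and its maximal ideal\<close>

context
  fixes H :: "nat set"
  assumes H: "nat_submonoid H"
begin

lemma cring_semigroup_ring: "cring (semigroup_ring H :: 'k::field fps ring)"
proof (rule cringI)
  show "abelian_group (semigroup_ring H :: 'k fps ring)"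
  proof (rule abelian_groupI; simp add: series_on_add)
    fix x :: "'k fps" assume "x \<in> series_on H"
    then show "\<exists>y\<in>series_on H. y + x = 0"
      by (intro bexI[of _ "- x"]) (simp_all add: series_on_uminus)
  qed
  show "comm_monoid (semigroup_ring H :: 'k fps ring)"
  proof (rule comm_monoidI; simp add: algebra_simps)
    fix x y :: "'k fps" assume "x \<in> series_on H" "y \<in> series_on H"
    then show "x * y \<in> series_on H"
      by (rule series_on_mult) (use H in \<open>auto simp: nat_submonoid_def\<close>)
  next
    show "(1 :: 'k fps) \<in> series_on H"
      using H by (simp add: series_on_def nat_submonoid_def)
  qed
qed (simp_all add: algebra_simps)

lemma uminus_semigroup_ring:
  fixes x :: "'k::field fps"
  assumes "x \<in> series_on H"
  shows "\<ominus>\<^bsub>semigroup_ring H\<^esub> x = - x"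
proof -
  interpret S: cring "semigroup_ring H :: 'k fps ring" by (rule cring_semigroup_ring)
  show ?thesis
    using S.minus_equality[of "- x" x] assms by (simp add: series_on_uminus)
qed

lemma minus_semigroup_ring:
  fixes x y :: "'k::field fps"
  assumes "y \<in> series_on H"
  shows "x \<ominus>\<^bsub>semigroup_ring H\<^esub> y = x - y"
  using assms by (simp add: a_minus_def uminus_semigroup_ring)

text \<open>The scalars of \<open>quotient_dim\<close> are the image of this set in the quotient
  ring, and the library's dimension theory asks that they form a subfield there.\<close>

lemma fps_const_subfield:
  "subfield (range fps_const) (semigroup_ring H :: 'k::field fps ring)" (is "subfield ?K ?S")
proof -
  interpret S: cring ?S by (rule cring_semigroup_ring)
  have const: "fps_const a \<in> series_on H" for a :: 'k
    using H by (simp add: fps_const_in_series_on nat_submonoid_def)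
  have "subring ?K ?S"
  proof (rule S.subringI)
    show "\<one>\<^bsub>?S\<^esub> \<in> ?K" by (auto intro: range_eqI[of _ _ 1])
    show "\<ominus>\<^bsub>?S\<^esub> x \<in> ?K" if x: "x \<in> ?K" for x
    proof -
      from x obtain a where "x = fps_const a" by blast
      then have "\<ominus>\<^bsub>?S\<^esub> x = fps_const (- a)" using const by (simp add: uminus_semigroup_ring)
      then show ?thesis by blast
    qed
  qed (auto simp: const)
  then have "subcring ?K ?S" by (rule S.subcringI')
  moreover have "Units (?S\<lparr>carrier := ?K\<rparr>) = ?K - {\<zero>\<^bsub>?S\<^esub>}"
  proof (intro equalityI subsetI)
    fix x assume "x \<in> ?K - {\<zero>\<^bsub>?S\<^esub>}"
    then obtain a where a: "x = fps_const a" "a \<noteq> 0" by auto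
    have "fps_const (inverse a) * x = 1" "x * fps_const (inverse a) = 1"
      using a by simp_all
    with a(1) show "x \<in> Units (?S\<lparr>carrier := ?K\<rparr>)"
      unfolding Units_def by (simp del: fps_const_mult) blast
  qed (auto simp: Units_def)
  ultimately show ?thesis by (rule S.subfieldI)
qed

text \<open>The hypotheses make \<open>A\<close> an ideal of the semigroup; absorption then passes
  from exponents to series by \<open>series_on_mult\<close>.\<close>

lemma ideal_series_on:
  assumes "A \<subseteq> H" "\<And>a h. a \<in> A \<Longrightarrow> h \<in> H \<Longrightarrow> a + h \<in> A"
  shows "ideal (series_on A) (semigroup_ring H :: 'k::field fps ring)" (is "ideal _ ?S")
proof -
  interpret S: cring ?S by (rule cring_semigroup_ring)
  have sub: "(series_on A :: 'k fps set) \<subseteq> series_on H"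
    using assms(1) by (rule series_on_mono)
  have mult: "x * a \<in> series_on A" "a * x \<in> series_on A"
    if "a \<in> series_on A" "x \<in> series_on H" for a x :: "'k fps"
    using series_on_mult[OF that(1,2), of A] assms(2) by (simp_all add: mult.commute)
  show ?thesis
  proof (rule idealI)
    show "subgroup (series_on A) (add_monoid ?S)"
    proof (rule S.add.subgroupI)
      show "(series_on A :: 'k fps set) \<noteq> {}" using series_on_0 by blast
    qed (use sub in \<open>auto simp: series_on_add series_on_uminus uminus_semigroup_ring subset_iff\<close>)
  qed (simp_all add: mult S.ring_axioms)
qed

text \<open>A series in the ring with nonzero constant term is a unit, so every proper ideal
  consists of series without constant term. Those series form an ideal themselves, hence the only
  maximal one.\<close>

lemma the_maximal_ideal_semigroup_ring:
  "the_maximal_ideal (semigroup_ring H :: 'k::field fps ring) = series_on (H - {0})"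
  (is "the_maximal_ideal ?S = ?N")
proof -
  interpret S: cring ?S by (rule cring_semigroup_ring)
  have 0: "0 \<in> H" using H by (simp add: nat_submonoid_def)
  have N: "ideal ?N ?S"
    by (rule ideal_series_on) (use H in \<open>auto simp: nat_submonoid_def\<close>)
  have proper: "J \<subseteq> ?N" if J: "ideal J ?S" "J \<noteq> carrier ?S" for J
  proof
    fix f assume f: "f \<in> J"
    interpret J: ideal J ?S by fact
    have fH: "f \<in> series_on H" using J.Icarr[OF f] by simp
    have "fps_nth f 0 = 0"
    proof (rule ccontr)
      assume f0: "fps_nth f 0 \<noteq> 0"
      then have "inverse f \<in> series_on H" using H fH by (intro inverse_in_series_on)
      then have "f * inverse f \<in> J" using J.I_r_closed[OF f] by simp
      then have "1 \<in> J" using f0 by (simp add: inverse_mult_eq_1')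
      then show False using J.one_imp_carrier J(2) by simp
    qed
    with fH show "f \<in> ?N" by (auto simp: series_on_def intro!: gr0I)
  qed
  have "1 \<in> carrier ?S" "1 \<notin> ?N"
    using 0 by (auto simp: series_on_def)
  then have N_proper: "?N \<noteq> carrier ?S" by blast
  show ?thesis
    unfolding the_maximal_ideal_def
  proof (rule the_equality)
    show "maximalideal ?N ?S"
      by (rule maximalidealI) (use N N_proper proper in auto)
  next
    fix M assume M: "maximalideal M ?S"
    then interpret M: maximalideal M ?S .
    have "M \<subseteq> ?N" using proper M.is_ideal M.I_notcarr by blast
    moreover have "?N \<subseteq> carrier ?S" by (simp add: series_on_mono)
    ultimately show "M = ?N" using M.I_maximal[OF N] N_proper by blast
  qed
qed

section \<open>Dimensions of monomial subquotients\<close>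

lemma PIdl_fps_X_power:
  "PIdl\<^bsub>semigroup_ring H\<^esub> (fps_X ^ e :: 'k::field fps) = series_on ((+) e ` H)"
proof (intro equalityI subsetI)
  fix f :: "'k fps"
  assume "f \<in> PIdl\<^bsub>semigroup_ring H\<^esub> (fps_X ^ e)"
  then obtain x where "x \<in> series_on H" "f = x * fps_X ^ e"
    by (auto simp: cgenideal_def)
  then show "f \<in> series_on ((+) e ` H)"
    using series_on_mult[of x H "fps_X ^ e" "{e}" "(+) e ` H"]
    by (auto simp: fps_X_power_in_series_on add.commute)
next
  fix f :: "'k fps"
  assume f: "f \<in> series_on ((+) e ` H)"
  \<comment> \<open>The quotient of \<open>f\<close> by t^e, which is exact because no element of
    \<open>e + H\<close> is below \<open>e\<close>.\<close>
  define x where "x = Abs_fps (\<lambda>n. fps_nth f (e + n))"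
  have "x \<in> series_on H"
    using f by (auto simp: series_on_def x_def)
  moreover have "f = x * fps_X ^ e"
  proof (rule fps_ext)
    fix n
    show "fps_nth f n = fps_nth (x * fps_X ^ e) n"
      using series_on_nth[OF f, of n] by (auto simp: fps_X_power_mult_right_nth x_def)
  qed
  ultimately show "f \<in> PIdl\<^bsub>semigroup_ring H\<^esub> (fps_X ^ e)"
    by (auto simp: cgenideal_def)
qed

text \<open>Induction on \<open>A\<close> follows the inductive definition of
  \<open>dimension\<close>: a new exponent \<open>a\<close> extends the space by the line through
  the class of t^a, which raises the dimension by one.\<close>

lemma quotient_dim_series_on:
  assumes e: "e \<in> H" "e \<noteq> 0"
    and A: "finite A" "A \<subseteq> H" "A \<inter> (+) e ` H = {}"
  shows "quotient_dim (semigroup_ring H :: 'k::field fps ring)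
      (series_on (A \<union> (+) e ` H)) (series_on ((+) e ` H)) = card A"
    (is "quotient_dim ?S _ ?I = _")
proof -
  have eH: "(+) e ` H \<subseteq> H" using e H by (auto simp: nat_submonoid_def)
  have 0: "0 \<in> H" using H by (simp add: nat_submonoid_def)
  interpret S: cring ?S by (rule cring_semigroup_ring)
  interpret I: ideal ?I ?S
    by (rule ideal_series_on[OF eH]) (use H in \<open>auto simp: nat_submonoid_def image_iff\<close>)
  interpret \<pi>: ring_hom_ring ?S "?S Quot ?I" "(+>\<^bsub>?S\<^esub>) ?I"
    by (rule I.rcos_ring_hom_ring)
  have coset_eq: "?I +>\<^bsub>?S\<^esub> x = ?I +>\<^bsub>?S\<^esub> y \<longleftrightarrow> x - y \<in> ?I"
    if "x \<in> series_on H" "y \<in> series_on H" for x y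
    using S.quotient_eq_iff_same_a_r_cos[OF I.is_ideal, of x y] that
    by (simp add: minus_semigroup_ring)
  let ?K = "range (\<lambda>a. ?I +>\<^bsub>?S\<^esub> fps_const a)"
  have K_eq: "?K = (+>\<^bsub>?S\<^esub>) ?I ` range fps_const" by (simp add: image_image)
  have const: "fps_const a \<in> series_on H" for a :: 'k
    using 0 by (rule fps_const_in_series_on)
  \<comment> \<open>Since \<open>e\<close> is not 0, the exponent 0 is missing from
    \<open>e + H\<close>. Hence the quotient is not the zero ring, and the image of the constants is
    again a subfield.\<close>
  have "(1 :: 'k fps) - 0 \<notin> ?I"
    using e by (auto simp: series_on_def)
  then have "\<one>\<^bsub>?S Quot ?I\<^esub> \<noteq> \<zero>\<^bsub>?S Quot ?I\<^esub>"
    using coset_eq[of 1 0] const[of 1] \<pi>.hom_one \<pi>.hom_zero by simp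
  then have K: "subfield ?K (?S Quot ?I)"
    unfolding K_eq by (rule \<pi>.img_is_subfield(2)[OF fps_const_subfield])
  have "\<pi>.S.dimension (card A) ?K ((+>\<^bsub>?S\<^esub>) ?I ` series_on (A \<union> (+) e ` H))"
    using A
  proof (induction A rule: finite_induct)
    case empty
    have "(+>\<^bsub>?S\<^esub>) ?I ` ?I = {\<zero>\<^bsub>?S Quot ?I\<^esub>}"
    proof -
      have "0 \<in> ?I" by simp
      then have "(+>\<^bsub>?S\<^esub>) ?I ` ?I = {?I}"
        using I.a_rcos_const by (intro equalityI subsetI) (auto simp: image_iff intro!: exI[of _ 0])
      then show ?thesis by (simp add: FactRing_def)
    qed
    then show ?case by simp
  next
    case (insert a A)
    let ?E = "(+>\<^bsub>?S\<^esub>) ?I ` series_on (A \<union> (+) e ` H)"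
    let ?v = "?I +>\<^bsub>?S\<^esub> (fps_X ^ a)"
    have aH: "(fps_X ^ a :: 'k fps) \<in> series_on H"
      using insert.prems by (intro fps_X_power_in_series_on) auto
    have sub: "(series_on (A \<union> (+) e ` H) :: 'k fps set) \<subseteq> series_on H"
      using insert.prems eH by (intro series_on_mono) auto
    have a: "a \<notin> A \<union> (+) e ` H" using insert.hyps insert.prems by auto
    have "?v \<in> carrier (?S Quot ?I)" using aH by simp
    \<comment> \<open>The coefficient at \<open>a\<close> decides: it is 1 for t^a, but 0 for
      \<open>y\<close> and for any series in the ideal.\<close>
    moreover have "?v \<notin> ?E"
    proof
      assume "?v \<in> ?E"
      then obtain y where y: "y \<in> series_on (A \<union> (+) e ` H)" "?v = ?I +>\<^bsub>?S\<^esub> y" by blast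
      then have "fps_X ^ a - y \<in> ?I" using coset_eq[of "fps_X ^ a" y] aH sub by blast
      then have "fps_nth (fps_X ^ a - y) a = 0" using a by (intro series_on_nth) auto
      then show False using series_on_nth[OF y(1) a] by simp
    qed
    ultimately have "\<pi>.S.dimension (Suc (card A)) ?K (\<pi>.S.line_extension ?K ?v ?E)"
      using insert.IH insert.prems by (intro \<pi>.S.dimension.Suc_dim) auto
    \<comment> \<open>The projection is a ring homomorphism, so the extension consists of the
      classes of all k t^a + \<open>y\<close>. It remains to identify these series by their
      support.\<close>
    moreover have "\<pi>.S.line_extension ?K ?v ?E
        = (+>\<^bsub>?S\<^esub>) ?I ` series_on (insert a A \<union> (+) e ` H)"
    proof -
      have hom: "(?I +>\<^bsub>?S\<^esub> fps_const k) \<otimes>\<^bsub>?S Quot ?I\<^esub> ?v \<oplus>\<^bsub>?S Quot ?I\<^esub> (?I +>\<^bsub>?S\<^esub> y)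
          = ?I +>\<^bsub>?S\<^esub> (fps_const k * fps_X ^ a + y)"
        if "y \<in> series_on (A \<union> (+) e ` H)" for k y
      proof -
        have "y \<in> series_on H" using that sub by blast
        then show ?thesis
          using \<pi>.hom_mult[of "fps_const k" "fps_X ^ a"]
            \<pi>.hom_add[of "fps_const k * fps_X ^ a" y] S.m_closed[of "fps_const k" "fps_X ^ a"]
            aH const by simp
      qed
      have "z \<in> \<pi>.S.line_extension ?K ?v ?E \<longleftrightarrow> (\<exists>k. \<exists>y\<in>series_on (A \<union> (+) e ` H).
          z = (?I +>\<^bsub>?S\<^esub> fps_const k) \<otimes>\<^bsub>?S Quot ?I\<^esub> ?v \<oplus>\<^bsub>?S Quot ?I\<^esub> (?I +>\<^bsub>?S\<^esub> y))" for z
        by (simp add: \<pi>.S.line_extension_def set_add_def' r_coset_def)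
      also have "(\<exists>k. \<exists>y\<in>series_on (A \<union> (+) e ` H).
          z = (?I +>\<^bsub>?S\<^esub> fps_const k) \<otimes>\<^bsub>?S Quot ?I\<^esub> ?v \<oplus>\<^bsub>?S Quot ?I\<^esub> (?I +>\<^bsub>?S\<^esub> y)) \<longleftrightarrow>
          (\<exists>k. \<exists>y\<in>series_on (A \<union> (+) e ` H). z = ?I +>\<^bsub>?S\<^esub> (fps_const k * fps_X ^ a + y))" for z
        using hom by (intro ex_cong1 bex_cong refl) simp
      finally have "\<pi>.S.line_extension ?K ?v ?E = (+>\<^bsub>?S\<^esub>) ?I ` {fps_const k * fps_X ^ a + y | k y.
          y \<in> series_on (A \<union> (+) e ` H)}"
        by blast
      also have "{fps_const k * fps_X ^ a + y | k y. y \<in> series_on (A \<union> (+) e ` H)}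
          = (series_on (insert a A \<union> (+) e ` H) :: 'k fps set)" (is "?L = ?R")
      proof (intro equalityI subsetI)
        fix f assume "f \<in> ?L"
        then show "f \<in> ?R" by (auto simp: series_on_def split: if_splits)
      next
        fix f assume f: "f \<in> ?R"
        \<comment> \<open>Subtracting the t^a term of \<open>f\<close> leaves a series without the
          exponent \<open>a\<close>.\<close>
        let ?y = "f - fps_const (fps_nth f a) * fps_X ^ a"
        have "?y \<in> series_on (A \<union> (+) e ` H)"
          using f by (fastforce simp: series_on_def)
        then show "f \<in> ?L"
          by (intro CollectI exI[of _ "fps_nth f a"] exI[of _ ?y]) simp
      qed
      finally show ?thesis .
    qed
    ultimately show ?case using insert.hyps by simp
  qed
  then show ?thesis
    using \<pi>.S.dimI[OF K] by (simp add: quotient_dim_def over_def)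
qed

text \<open>A series supported on a union splits by exponents: keep those in \<open>B\<close>, and
  the rest starts at the conductor. Sums of monomial ideals thus become unions.\<close>

lemma conductor_ideal_add:
  assumes "{conductor H..} \<subseteq> H"
  shows "(conductor_ideal H :: 'k::field fps set) <+>\<^bsub>semigroup_ring H\<^esub> series_on B
      = series_on ({conductor H..} \<union> B)"
proof -
  have C: "(conductor_ideal H :: 'k fps set) = series_on {conductor H..}"
  proof (intro equalityI subsetI)
    fix f :: "'k fps" assume "f \<in> conductor_ideal H"
    then show "f \<in> series_on {conductor H..}"
      by (auto simp: conductor_ideal_def series_on_def fps_X_power_mult_nth split: if_splits)
  next
    fix f :: "'k fps" assume f: "f \<in> series_on {conductor H..}"
    have "f = fps_X ^ conductor H * fps_shift (conductor H) f"
      by (rule fps_ext) (use f in \<open>auto simp: fps_X_power_mult_nth series_on_def\<close>)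
    then show "f \<in> conductor_ideal H" by (auto simp: conductor_ideal_def)
  qed
  show ?thesis
  proof (intro equalityI subsetI)
    fix f :: "'k fps"
    assume "f \<in> conductor_ideal H <+>\<^bsub>semigroup_ring H\<^esub> series_on B"
    then show "f \<in> series_on ({conductor H..} \<union> B)"
      unfolding C set_add_def' semigroup_ring_simps
      using series_on_mono[of "{conductor H..}" "{conductor H..} \<union> B"]
        series_on_mono[of B "{conductor H..} \<union> B"] by (auto intro!: series_on_add)
  next
    fix f :: "'k fps"
    assume f: "f \<in> series_on ({conductor H..} \<union> B)"
    define g where "g = Abs_fps (\<lambda>n. if n \<in> B then fps_nth f n else 0)"
    have "f - g \<in> series_on {conductor H..}" "g \<in> series_on B"
      using f by (auto simp: series_on_def g_def)
    moreover have "f = (f - g) + g" by simp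
    ultimately show "f \<in> conductor_ideal H <+>\<^bsub>semigroup_ring H\<^esub> series_on B"
      unfolding C set_add_def' semigroup_ring_simps by blast
  qed
qed

text \<open>Testing against the monomials t^a with \<open>a\<close> in \<open>A\<close> determines
  the support, since the coefficient of \<open>f\<close> at \<open>n\<close> reappears in f t^a at
  \<open>n + a\<close>.\<close>

lemma colon_ideal_series_on:
  "colon_ideal (semigroup_ring H :: 'k::field fps ring) (series_on B) (series_on A)
    = series_on {n \<in> H. \<forall>a\<in>A. n + a \<in> B}"
proof (intro equalityI subsetI)
  fix f :: "'k fps"
  assume "f \<in> colon_ideal (semigroup_ring H) (series_on B) (series_on A)"
  then have f: "f \<in> series_on H" "\<And>g. g \<in> series_on A \<Longrightarrow> f * g \<in> series_on B"
    by (auto simp: colon_ideal_def)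
  have "n + a \<in> B" if "fps_nth f n \<noteq> 0" "a \<in> A" for n a
    using f(2)[OF fps_X_power_in_series_on[OF that(2)]] that(1)
    by (auto simp: series_on_def fps_X_power_mult_right_nth dest!: spec[of _ "n + a"])
  with f(1) show "f \<in> series_on {n \<in> H. \<forall>a\<in>A. n + a \<in> B}"
    by (auto simp: series_on_def)
next
  fix f :: "'k fps"
  assume f: "f \<in> series_on {n \<in> H. \<forall>a\<in>A. n + a \<in> B}"
  have "f * g \<in> series_on B" if "g \<in> series_on A" for g
    by (rule series_on_mult[OF f that]) auto
  moreover have "f \<in> series_on H"
    using f series_on_mono[of "{n \<in> H. \<forall>a\<in>A. n + a \<in> B}" H] by auto
  ultimately show "f \<in> colon_ideal (semigroup_ring H) (series_on B) (series_on A)"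
    by (simp add: colon_ideal_def)
qed

end

section \<open>Comparison of the two types\<close>

text \<open>The complement is bounded, so the \<open>LEAST\<close> is attained. Its minimality keeps
  the Frobenius number c - 1 out of \<open>H\<close>, while adding a positive integer to c - 1
  reaches c or more. The second part later shows that \<open>PF H\<close> is nonempty.\<close>

lemma conductor_numerical_semigroup:
  assumes "numerical_semigroup H"
  shows "{conductor H..} \<subseteq> H" and "H \<noteq> UNIV \<Longrightarrow> int (conductor H) - 1 \<in> PF H"
proof -
  have "finite (- H)" using assms by (simp add: numerical_semigroup_def Compl_eq_Diff_UNIV)
  then obtain N where "\<forall>n\<in>- H. n \<le> N" using finite_nat_set_iff_bounded_le by blast
  then have "\<forall>i. Suc N + i \<in> H" by (metis ComplI Suc_n_not_le_n add_leD1 add_Suc)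
  then have *: "\<forall>i. conductor H + i \<in> H"
    unfolding conductor_def by (rule LeastI[where P = "\<lambda>c. \<forall>i. c + i \<in> H"])
  show sub: "{conductor H..} \<subseteq> H"
  proof
    fix n assume "n \<in> {conductor H..}"
    then have "n = conductor H + (n - conductor H)" by simp
    with * show "n \<in> H" by metis
  qed
  assume "H \<noteq> UNIV"
  \<comment> \<open>This makes the truncated subtraction in \<open>conductor H - 1\<close>
    exact.\<close>
  then have c: "conductor H \<noteq> 0" using * by (metis add_0 UNIV_eq_I)
  have "conductor H - 1 \<notin> H"
  proof
    assume c1: "conductor H - 1 \<in> H"
    have "conductor H - 1 + i \<in> H" for i
    proof (cases i)
      case (Suc j)
      then have "conductor H - 1 + i = conductor H + j" using c by simp
      with * show ?thesis by simp
    qed (use c1 in simp)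
    then have "conductor H \<le> conductor H - 1"
      by (subst conductor_def) (simp add: Least_le)
    with c show False by simp
  qed
  moreover have "int (conductor H) - 1 = int (conductor H - 1)" using c by simp
  moreover have "int (conductor H) - 1 + int h \<in> int ` H" if "h \<noteq> 0" for h
  proof -
    have "conductor H - 1 + h \<in> H" using sub c that by (auto simp: subset_iff)
    moreover have "int (conductor H) - 1 + int h = int (conductor H - 1 + h)" using c by simp
    ultimately show ?thesis by blast
  qed
  ultimately show "int (conductor H) - 1 \<in> PF H"
    unfolding PF_def by (simp add: inj_image_mem_iff del: of_nat_diff)
qed

text \<open>The minimal generating set enters the proof only through these facts: \<open>b 1\<close>
  is the multiplicity of \<open>H\<close>, its least nonzero element.\<close>

lemma first_generator:
  fixes m :: nat and b :: "nat \<Rightarrow> nat"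
  assumes "numerical_semigroup H" and "strict_mono_on {1..m} b"
    and "minimally_generates (b ` {1..m}) H"
  shows "b 1 \<in> H" "b 1 \<noteq> 0" "\<And>h. h \<in> H \<Longrightarrow> h \<noteq> 0 \<Longrightarrow> b 1 \<le> h"
proof -
  let ?B = "b ` {1..m}"
  have gen: "nat_submonoid hull ?B = H" and minimal: "\<And>B'. B' \<subset> ?B \<Longrightarrow> nat_submonoid hull B' \<noteq> H"
    using assms(3) by (auto simp: minimally_generates_def)
  have inf: "infinite H"
    using assms(1) by (metis numerical_semigroup_def Diff_infinite_finite infinite_UNIV_nat)
  have "m \<noteq> 0"
  proof
    assume "m = 0"
    then have "?B \<subseteq> {0}" by simp
    then have "H \<subseteq> {0}"
      unfolding gen[symmetric] by (rule hull_minimal) (simp add: nat_submonoid_def)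
    with inf show False using finite_subset by blast
  qed
  then have m: "1 \<in> {1..m}" by simp
  show "b 1 \<in> H" unfolding gen[symmetric] using m by (intro hull_inc) blast
  show "b 1 \<noteq> 0"
  proof
    assume "b 1 = 0"
    then have "0 \<in> ?B" using m by force
    \<comment> \<open>Every submonoid contains 0, so a generator 0 could be dropped without changing
      the hull, against minimality.\<close>
    have "nat_submonoid T \<and> ?B - {0} \<subseteq> T \<longleftrightarrow> nat_submonoid T \<and> ?B \<subseteq> T" for T
      by (auto simp: nat_submonoid_def)
    then have "nat_submonoid hull (?B - {0}) = nat_submonoid hull ?B"
      unfolding hull_def by presburger
    with minimal[of "?B - {0}"] gen \<open>0 \<in> ?B\<close> show False by auto
  qed
  have "b 1 \<le> b i" if "i \<in> {1..m}" for i
  proof (cases "i = 1")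
    case False
    with that have "b 1 < b i" using strict_mono_onD[OF assms(2) m that] by simp
    then show ?thesis by simp
  qed simp
  \<comment> \<open>The set on the right is a submonoid containing all generators, hence it contains
    their hull.\<close>
  then have "H \<subseteq> insert 0 {b 1..}"
    unfolding gen[symmetric] by (intro hull_minimal) (auto simp: nat_submonoid_def)
  then show "b 1 \<le> h" if "h \<in> H" "h \<noteq> 0" for h using that by auto
qed

text \<open>An element outside \<open>e + H\<close> is either below \<open>e\<close> or the shift by
  \<open>e\<close> of one of the finitely many gaps. This bounds both exponent sets that are counted
  in the end.\<close>

lemma finite_Diff_shift:
  assumes "numerical_semigroup H"
  shows "finite (H - (+) e ` H)"
proof (rule finite_subset)
  show "H - (+) e ` H \<subseteq> {..<e} \<union> (+) e ` (UNIV - H)"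
  proof
    fix n assume n: "n \<in> H - (+) e ` H"
    show "n \<in> {..<e} \<union> (+) e ` (UNIV - H)"
    proof (cases "n < e")
      case False
      then have "n = e + (n - e)" by simp
      with n show ?thesis by blast
    qed simp
  qed
  show "finite ({..<e} \<union> (+) e ` (UNIV - H))"
    using assms by (simp add: numerical_semigroup_def)
qed

text \<open>Shifting by \<open>e\<close> turns pseudo-Frobenius numbers into socle exponents: the
  right side says that the class of t^n modulo t^e is nonzero and annihilated by the maximal
  ideal.\<close>

lemma PF_shift_iff:
  assumes "0 \<in> H" and n: "n \<in> H"
  shows "int n - int e \<in> PF H \<longleftrightarrow> n \<notin> (+) e ` H \<and> (\<forall>h\<in>H - {0}. n + h \<in> (+) e ` H)"
proof -
  have "int k - int e \<in> int ` H \<longleftrightarrow> k \<in> (+) e ` H" for k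
  proof
    assume "int k - int e \<in> int ` H"
    then obtain h where "h \<in> H" "int k - int e = int h" by blast
    then show "k \<in> (+) e ` H" by (intro image_eqI[of _ _ h]) auto
  qed auto
  from this[of n] this[of "n + _"] show ?thesis
    by (auto simp: PF_def algebra_simps)
qed

theorem proposition3p7:
  fixes H :: "nat set" and m :: nat and b :: "nat \<Rightarrow> nat"
  assumes "numerical_semigroup H" and "H \<noteq> UNIV"
    and "strict_mono_on {1..m} b" and "minimally_generates (b ` {1..m}) H"
  shows "maximal_reduced_type TYPE('k::{alg_closed_field, field_char_0}) H (b 1)
    \<longleftrightarrow> Min (PF H) \<ge> int (conductor H) - int (b 1)"
proof -
  define e where "e = b 1"
  define c where "c = conductor H"
  have H: "nat_submonoid H" and 0: "0 \<in> H"
    using assms(1) by (auto simp: numerical_semigroup_def nat_submonoid_def)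
  note gen = first_generator[OF assms(1,3,4), folded e_def]
  note cond = conductor_numerical_semigroup[OF assms(1), folded c_def]
  let ?eH = "(+) e ` H"
  define R where "R = {c..} - ?eH"
  define T where "T = {n \<in> H. int n - int e \<in> PF H}"
  have eH: "?eH \<subseteq> H" using H gen(1) by (auto simp: nat_submonoid_def)
  have T_sub: "T \<subseteq> H - ?eH" using PF_shift_iff[OF 0] by (auto simp: T_def)
  then have fin: "finite T" using finite_Diff_shift[OF assms(1)] finite_subset by blast
  have R_sub: "R \<subseteq> T"
  proof
    fix n assume n: "n \<in> R"
    then have nH: "n \<in> H" using cond(1) by (auto simp: R_def)
    have "n + h \<in> ?eH" if "h \<in> H - {0}" for h
    proof (rule image_eqI)
      \<comment> \<open>As \<open>e\<close> is the least nonzero element of \<open>H\<close>, the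
        number \<open>n + h - e\<close> is at least \<open>n\<close>, hence at least
        \<open>c\<close>.\<close>
      have "e \<le> h" using gen(3) that by simp
      then show "n + h = e + (n + h - e)" "n + h - e \<in> H"
        using n cond(1) by (auto simp: R_def subset_iff)
    qed
    with n nH show "n \<in> T"
      using PF_shift_iff[OF 0 nH, of e] by (simp add: R_def T_def)
  qed
  \<comment> \<open>Adding the nonzero element \<open>e\<close> of \<open>H\<close> moves every
    pseudo-Frobenius number into \<open>H\<close>, so the condition \<open>n \<in> H\<close> in
    \<open>T\<close> loses none of them.\<close>
  have PF_eq: "PF H = (\<lambda>n. int n - int e) ` T"
  proof (intro equalityI subsetI)
    fix x assume x: "x \<in> PF H"
    then obtain n where "n \<in> H" "x + int e = int n" using gen(1,2) by (auto simp: PF_def)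
    moreover from this have "x = int n - int e" by simp
    ultimately show "x \<in> (\<lambda>n. int n - int e) ` T"
      using x by (simp add: T_def)
  qed (auto simp: T_def)

  have "reduced_type TYPE('k) H e = card R"
  proof -
    have "{c..} \<union> ?eH = R \<union> ?eH" by (auto simp: R_def)
    moreover have "finite R" "R \<subseteq> H" "R \<inter> ?eH = {}"
      using finite_subset[OF R_sub fin] R_sub T_sub by auto
    ultimately show ?thesis
      using quotient_dim_series_on[OF H gen(1,2), of R, where 'k = 'k]
        conductor_ideal_add[OF H cond(1)[unfolded c_def], of ?eH, where 'k = 'k]
      by (simp add: reduced_type_def Let_def PIdl_fps_X_power[OF H] c_def[symmetric])
  qed
  moreover have "cm_type TYPE('k) H e = card T"
  proof -
    \<comment> \<open>On the left are the exponents of the colon ideal. Those in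
      \<open>e + H\<close> qualify because \<open>e + H\<close> absorbs \<open>H\<close>; the others
      are the socle exponents.\<close>
    have "{n \<in> H. \<forall>h\<in>H - {0}. n + h \<in> ?eH} = T \<union> ?eH"
      using eH PF_shift_iff[OF 0, of _ e] H
      by (auto simp: T_def nat_submonoid_def add.assoc)
    then show ?thesis
      using quotient_dim_series_on[OF H gen(1,2), of T, where 'k = 'k] T_sub fin
      by (auto simp: cm_type_def Let_def PIdl_fps_X_power[OF H] colon_ideal_series_on[OF H]
          the_maximal_ideal_semigroup_ring[OF H])
  qed
  ultimately have "maximal_reduced_type TYPE('k) H e \<longleftrightarrow> card R = card T"
    by (simp add: maximal_reduced_type_def)
  also have "\<dots> \<longleftrightarrow> R = T"
    using card_subset_eq[OF fin R_sub] by auto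
  \<comment> \<open>\<open>T\<close> avoids \<open>e + H\<close>, so \<open>R\<close> is exactly the
    part of \<open>T\<close> from \<open>c\<close> on.\<close>
  also have "\<dots> \<longleftrightarrow> (\<forall>n\<in>T. c \<le> n)"
    using R_sub T_sub by (auto simp: R_def)
  also have "\<dots> \<longleftrightarrow> (\<forall>x\<in>PF H. int c - int e \<le> x)"
    unfolding PF_eq by auto
  also have "\<dots> \<longleftrightarrow> int c - int e \<le> Min (PF H)"
  proof -
    \<comment> \<open>\<open>Min\<close> is the least element only for a finite nonempty set; the
      Frobenius number provides an element.\<close>
    have "finite (PF H)" using fin by (simp add: PF_eq)
    moreover have "PF H \<noteq> {}" using cond(2) assms(2) by blast
    ultimately show ?thesis by simp
  qed
  finally show ?thesis by (simp add: e_def c_def)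
qed

end
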